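(* Let $\mathbf A$ be a Łukasiewicz near semiring and $a\in A$. Then the least ideal $I(a)$ of $\mathbf A$ containing $a$ is $I(a)=\{p(a): p\in \mathrm{Pol}_1(\mathbf A),\ p(0)=0\}$.
   Context: An $\iota$-near semiring is an algebra $\langle A,+,\cdot,{}^{\alpha},0,1\rangle$ of type $\langle 2,2,1,0,0\rangle$ such that $\langle A,+\rangle$ is a join semilattice with least element $0$ and greatest element $1$ (order $x\le y$ iff $x+y=y$), $x\cdot1=x=1\cdot x$, $(x+y)\cdot z=xz+yz$, $x0=0x=0$, $(x^{\alpha})^{\alpha}=x$, and $x\le y$ implies $y^{\alpha}\le x^{\alpha}$. A Łukasiewicz near semiring is an $\iota$-near semiring satisfying $(x y^{\alpha})^{\alpha} y^{\alpha}=(y x^{\alpha})^{\alpha} x^{\alpha}$. Juxtaposition $xy$ denotes $x\cdot y$. An ideal of $\mathbf A$ is a set $I\subseteq A$ with $0\in I$ such that (I1) if $ab^{\alpha}\in I$ and $b\in I$ then $a\in I$; (I2) if $a^{\alpha}b\in I$ and $b^{\alpha}a\in I$ then $(ac)^{\alpha}(bc)\in I$ and $(ca)^{\alpha}(cb)\in I$ for every $c\in A$. $\mathrm{Pol}_1(\mathbf A)$ is the set of unary polynomials of $\mathbf A$, i.e. functions $x\mapsto t^{\mathbf A}(x,e_1,\dots,e_n)$ with $t$ an $(n+1)$-ary term in the signature $(+,\cdot,{}^{\alpha},0,1)$ and $e_1,\dots,e_n\in A$. *)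

theory Defs
  imports Main
begin

text \<open>
  A join semilattice with least element \<open>0\<close> and greatest element \<open>1\<close>, written additively:
  neutrality of \<open>0\<close>, inherited from \<^class>\<open>comm_monoid_add\<close>, says that \<open>0\<close> is least.
  The one-element algebra (\<open>0 = 1\<close>) is allowed.
\<close>
class bounded_join_semilattice_add = comm_monoid_add + one +
  assumes add_idem: "x + x = x"
    and add_one: "x + 1 = 1"
begin

definition join_le :: "'a \<Rightarrow> 'a \<Rightarrow> bool"  (infix "\<sqsubseteq>" 50)
  where "x \<sqsubseteq> y \<longleftrightarrow> x + y = y"

end

text \<open>
  Multiplication is neither associative nor commutative, and it distributes over \<open>+\<close> from the
  right only; \<open>x * 0 = 0 = 0 * x\<close> is inherited from \<^class>\<open>mult_zero\<close>.
\<close>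
class iota_near_semiring = bounded_join_semilattice_add + mult_zero +
  fixes alpha :: "'a \<Rightarrow> 'a"  ("_\<^sup>\<alpha>" [1000] 999)
  assumes mult_one_right: "x * 1 = x"
    and mult_one_left: "1 * x = x"
    and add_mult_distrib_right: "(x + y) * z = x * z + y * z"
    and alpha_involutive: "(x\<^sup>\<alpha>)\<^sup>\<alpha> = x"
    and alpha_antitone: "x \<sqsubseteq> y \<Longrightarrow> y\<^sup>\<alpha> \<sqsubseteq> x\<^sup>\<alpha>"

class lukasiewicz_near_semiring = iota_near_semiring +
  assumes lukasiewicz: "(x * y\<^sup>\<alpha>)\<^sup>\<alpha> * y\<^sup>\<alpha> = (y * x\<^sup>\<alpha>)\<^sup>\<alpha> * x\<^sup>\<alpha>"

definition is_ideal :: "'a::lukasiewicz_near_semiring set \<Rightarrow> bool" where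
  "is_ideal I \<longleftrightarrow>
     0 \<in> I \<and>
     (\<forall>a b. a * b\<^sup>\<alpha> \<in> I \<and> b \<in> I \<longrightarrow> a \<in> I) \<and>
     (\<forall>a b. a\<^sup>\<alpha> * b \<in> I \<and> b\<^sup>\<alpha> * a \<in> I \<longrightarrow>
        (\<forall>c. (a * c)\<^sup>\<alpha> * (b * c) \<in> I \<and> (c * a)\<^sup>\<alpha> * (c * b) \<in> I))"

definition is_least_ideal_containing ::
    "'a::lukasiewicz_near_semiring \<Rightarrow> 'a set \<Rightarrow> bool" where
  "is_least_ideal_containing a I \<longleftrightarrow>
     is_ideal I \<and> a \<in> I \<and> (\<forall>J. is_ideal J \<and> a \<in> J \<longrightarrow> I \<subseteq> J)"

datatype nsr_term =
    Var nat
  | Zero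
  | One
  | Add nsr_term nsr_term
  | Mult nsr_term nsr_term
  | Alpha nsr_term

primrec vars :: "nsr_term \<Rightarrow> nat set" where
  "vars (Var i) = {i}"
| "vars Zero = {}"
| "vars One = {}"
| "vars (Add s t) = vars s \<union> vars t"
| "vars (Mult s t) = vars s \<union> vars t"
| "vars (Alpha t) = vars t"

primrec eval_term :: "(nat \<Rightarrow> 'a::lukasiewicz_near_semiring) \<Rightarrow> nsr_term \<Rightarrow> 'a" where
  "eval_term \<sigma> (Var i) = \<sigma> i"
| "eval_term \<sigma> Zero = 0"
| "eval_term \<sigma> One = 1"
| "eval_term \<sigma> (Add s t) = eval_term \<sigma> s + eval_term \<sigma> t"
| "eval_term \<sigma> (Mult s t) = eval_term \<sigma> s * eval_term \<sigma> t"
| "eval_term \<sigma> (Alpha t) = (eval_term \<sigma> t)\<^sup>\<alpha>"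

text \<open>
  With \<open>es = [e\<^sub>1, \<dots>, e\<^sub>n]\<close>, an \<open>(n+1)\<close>-ary term has its variables among \<open>0, \<dots>, n\<close>; variable \<open>0\<close>
  takes the argument \<open>x\<close> and variable \<open>i\<close> the parameter \<open>e\<^sub>i\<close>.
\<close>
definition Pol1 :: "('a::lukasiewicz_near_semiring \<Rightarrow> 'a) set" where
  "Pol1 = {(\<lambda>x. eval_term (\<lambda>i. (x # es) ! i) t) | t es. vars t \<subseteq> {..length es}}"

end

theory Submission
  imports Defs
begin

text \<open>
  In a Lukasiewicz near semiring \<open>(x\<^sup>\<alpha> * y)\<^sup>\<alpha> * y\<close> is the meet of \<open>x\<close> and \<open>y\<close>, so meets and joins
  are terms in \<open>*\<close> and \<open>\<alpha>\<close>. Hence every ideal \<open>J\<close> is the \<open>0\<close>-class of the congruence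
  \<open>x\<^sup>\<alpha> * y \<in> J \<and> y\<^sup>\<alpha> * x \<in> J\<close>, and so contains \<open>p a\<close> whenever \<open>a \<in> J\<close> and \<open>p 0 = 0\<close>.
  Conversely, the values \<open>p a\<close> form a set \<open>V\<close> that is closed downwards and under
  \<open>(u\<^sup>\<alpha> * v\<^sup>\<alpha>)\<^sup>\<alpha>\<close>, which gives (I1) because this term equals \<open>x + y\<close> at \<open>u = x * y\<^sup>\<alpha>\<close> and \<open>v = y\<close>.
  For (I2), the relation that \<open>V\<close> induces holds between \<open>x\<close> and \<open>y\<close> iff they are the values at \<open>a\<close>
  of two polynomials that agree at \<open>0\<close>, a condition that multiplication by \<open>c\<close> preserves.
\<close>

subsection \<open>Order, meets and joins\<close>

context bounded_join_semilattice_add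
begin

sublocale join: bounded_semilattice_sup_bot "(+)" "(\<sqsubseteq>)" "\<lambda>x y. x \<sqsubseteq> y \<and> x \<noteq> y" 0
proof
  show refl: "x \<sqsubseteq> x" for x
    by (simp add: join_le_def add_idem)
  show antisym: "x \<sqsubseteq> y \<Longrightarrow> y \<sqsubseteq> x \<Longrightarrow> x = y" for x y
    by (metis join_le_def add.commute)
  show "x \<sqsubseteq> y \<Longrightarrow> y \<sqsubseteq> z \<Longrightarrow> x \<sqsubseteq> z" for x y z
    by (metis join_le_def add.assoc)
  show "(x \<sqsubseteq> y \<and> x \<noteq> y) = (x \<sqsubseteq> y \<and> \<not> y \<sqsubseteq> x)" for x y
    using refl antisym by blast
  show "x \<sqsubseteq> x + y" "y \<sqsubseteq> x + y" for x y
    by (metis join_le_def add.assoc add.commute add_idem)+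
  show "y \<sqsubseteq> x \<Longrightarrow> z \<sqsubseteq> x \<Longrightarrow> y + z \<sqsubseteq> x" for x y z
    by (metis join_le_def add.assoc)
  show "0 \<sqsubseteq> x" for x
    by (simp add: join_le_def)
qed

sublocale join: order_top "(\<sqsubseteq>)" "\<lambda>x y. x \<sqsubseteq> y \<and> x \<noteq> y" 1
  by unfold_locales (simp add: join_le_def add_one)

end

context iota_near_semiring
begin

lemma mult_right_mono_join: "x \<sqsubseteq> y \<Longrightarrow> x * z \<sqsubseteq> y * z"
  by (metis join_le_def add_mult_distrib_right)

lemma mult_join_le_right: "x * y \<sqsubseteq> y"
  using mult_right_mono_join[OF join.top_greatest, of x y] by (simp add: mult_one_left)

lemma alpha_join_le_swap: "x \<sqsubseteq> y\<^sup>\<alpha> \<Longrightarrow> y \<sqsubseteq> x\<^sup>\<alpha>"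
  by (metis alpha_antitone alpha_involutive)

lemma alpha_zero: "0\<^sup>\<alpha> = 1"
  by (rule join.top_le) (rule alpha_join_le_swap[OF join.bot_least])

lemma alpha_one: "1\<^sup>\<alpha> = 0"
  by (metis alpha_zero alpha_involutive)

end

context lukasiewicz_near_semiring
begin

lemma mult_alpha_self: "x * x\<^sup>\<alpha> = 0"
  using lukasiewicz[of 1 x] by (simp add: alpha_one alpha_involutive mult_one_left)

lemma alpha_mult_self: "x\<^sup>\<alpha> * x = 0"
  by (metis mult_alpha_self alpha_involutive)

lemma mult_eq_zeroI: "x \<sqsubseteq> y\<^sup>\<alpha> \<Longrightarrow> x * y = 0"
  using mult_right_mono_join[of x "y\<^sup>\<alpha>" y] by (simp add: alpha_mult_self join.bot_unique)

definition near_meet :: "'a \<Rightarrow> 'a \<Rightarrow> 'a"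
  where "near_meet x y = (x\<^sup>\<alpha> * y)\<^sup>\<alpha> * y"

lemma near_meet_commute: "near_meet x y = near_meet y x"
  using lukasiewicz[of "x\<^sup>\<alpha>" "y\<^sup>\<alpha>"] by (simp add: near_meet_def alpha_involutive)

lemma near_meet_absorb: "x \<sqsubseteq> y \<Longrightarrow> near_meet x y = x"
  by (simp add: near_meet_commute[of x] near_meet_def[of y] mult_eq_zeroI alpha_antitone
      alpha_zero mult_one_left)

lemma near_meet_mono_left: "x \<sqsubseteq> y \<Longrightarrow> near_meet x z \<sqsubseteq> near_meet y z"
  by (simp add: near_meet_def alpha_antitone mult_right_mono_join)

sublocale near_lattice:
  bounded_lattice near_meet "(\<sqsubseteq>)" "\<lambda>x y. x \<sqsubseteq> y \<and> x \<noteq> y" "(+)" 0 1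
proof
  show le_right: "near_meet x y \<sqsubseteq> y" for x y
    by (simp add: near_meet_def mult_join_le_right)
  show "near_meet x y \<sqsubseteq> x" for x y
    by (metis near_meet_commute le_right)
  show "x \<sqsubseteq> y \<Longrightarrow> x \<sqsubseteq> z \<Longrightarrow> x \<sqsubseteq> near_meet y z" for x y z
    by (metis near_meet_absorb near_meet_mono_left)
qed

lemma add_eq_alpha_near_meet: "x + y = (near_meet (x\<^sup>\<alpha>) (y\<^sup>\<alpha>))\<^sup>\<alpha>"
proof (rule join.order.antisym)
  show "x + y \<sqsubseteq> (near_meet (x\<^sup>\<alpha>) (y\<^sup>\<alpha>))\<^sup>\<alpha>"
    by (rule join.sup_least; rule alpha_join_le_swap;
        rule near_lattice.inf_le1 near_lattice.inf_le2)
  have "(x + y)\<^sup>\<alpha> \<sqsubseteq> near_meet (x\<^sup>\<alpha>) (y\<^sup>\<alpha>)"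
    by (intro near_lattice.inf_greatest alpha_antitone join.sup_ge1 join.sup_ge2)
  then show "(near_meet (x\<^sup>\<alpha>) (y\<^sup>\<alpha>))\<^sup>\<alpha> \<sqsubseteq> x + y"
    by (metis alpha_antitone alpha_involutive)
qed

lemma add_eq_mult_alpha: "x + y = ((x * y\<^sup>\<alpha>)\<^sup>\<alpha> * y\<^sup>\<alpha>)\<^sup>\<alpha>"
  by (simp add: add_eq_alpha_near_meet near_meet_def alpha_involutive)

end

subsection \<open>Unary polynomials\<close>

lemma Pol1I: "vars t \<subseteq> {..length es} \<Longrightarrow> (\<lambda>x. eval_term (nth (x # es)) t) \<in> Pol1"
  by (auto simp: Pol1_def)

lemma Pol1E:
  assumes "p \<in> Pol1"
  obtains t es where "vars t \<subseteq> {..length es}" "p = (\<lambda>x. eval_term (nth (x # es)) t)"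
  using assms by (auto simp: Pol1_def)

lemma eval_term_cong:
  "(\<And>i. i \<in> vars t \<Longrightarrow> \<sigma> i = \<tau> i) \<Longrightarrow> eval_term \<sigma> t = eval_term \<tau> t"
  by (induction t) simp_all

primrec rename_vars :: "(nat \<Rightarrow> nat) \<Rightarrow> nsr_term \<Rightarrow> nsr_term" where
  "rename_vars f (Var i) = Var (f i)"
| "rename_vars f Zero = Zero"
| "rename_vars f One = One"
| "rename_vars f (Add s t) = Add (rename_vars f s) (rename_vars f t)"
| "rename_vars f (Mult s t) = Mult (rename_vars f s) (rename_vars f t)"
| "rename_vars f (Alpha t) = Alpha (rename_vars f t)"

lemma vars_rename_vars: "vars (rename_vars f t) = f ` vars t"
  by (induction t) (simp_all add: image_Un)

lemma eval_term_rename_vars: "eval_term \<sigma> (rename_vars f t) = eval_term (\<sigma> \<circ> f) t"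
  by (induction t) simp_all

definition shift_parameter :: "nat \<Rightarrow> nat \<Rightarrow> nat"
  where "shift_parameter n i = (if i = 0 then 0 else n + i)"

lemma eval_term_append_parameters:
  assumes "vars t \<subseteq> {..length es}"
  shows "eval_term (nth (x # es @ fs)) t = eval_term (nth (x # es)) t"
proof (rule eval_term_cong)
  fix i assume "i \<in> vars t"
  then have "i < length (x # es)"
    using assms by auto
  then show "(x # es @ fs) ! i = (x # es) ! i"
    by (metis append_Cons nth_append)
qed

lemma eval_term_prepend_parameters:
  "eval_term (nth (x # es @ fs)) (rename_vars (shift_parameter (length es)) t) =
    eval_term (nth (x # fs)) t"
  unfolding eval_term_rename_vars
proof (rule eval_term_cong)
  fix i
  show "(nth (x # es @ fs) \<circ> shift_parameter (length es)) i = (x # fs) ! i"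
    by (cases i) (simp_all add: shift_parameter_def nth_append)
qed

lemma Pol1_common_parameters:
  assumes "p \<in> Pol1" "q \<in> Pol1"
  obtains s t es where "vars s \<subseteq> {..length es}" "vars t \<subseteq> {..length es}"
    "p = (\<lambda>x. eval_term (nth (x # es)) s)" "q = (\<lambda>x. eval_term (nth (x # es)) t)"
proof -
  obtain s es where s: "vars s \<subseteq> {..length es}" "p = (\<lambda>x. eval_term (nth (x # es)) s)"
    using assms(1) by (rule Pol1E)
  obtain t fs where t: "vars t \<subseteq> {..length fs}" "q = (\<lambda>x. eval_term (nth (x # fs)) t)"
    using assms(2) by (rule Pol1E)
  let ?t = "rename_vars (shift_parameter (length es)) t"
  show thesis
  proof (rule that)
    show "vars s \<subseteq> {..length (es @ fs)}"
      using s(1) by auto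
    show "vars ?t \<subseteq> {..length (es @ fs)}"
      using t(1) by (auto simp: vars_rename_vars shift_parameter_def)
    show "p = (\<lambda>x. eval_term (nth (x # es @ fs)) s)"
      by (simp add: s eval_term_append_parameters)
    show "q = (\<lambda>x. eval_term (nth (x # es @ fs)) ?t)"
      by (simp add: t(2) eval_term_prepend_parameters)
  qed
qed

lemma Pol1_id: "(\<lambda>x. x) \<in> Pol1"
  using Pol1I[of "Var 0" "[]"] by simp

lemma Pol1_const: "(\<lambda>x. c) \<in> Pol1"
  using Pol1I[of "Var 1" "[c]"] by simp

lemma Pol1_alpha:
  assumes "p \<in> Pol1"
  shows "(\<lambda>x. (p x)\<^sup>\<alpha>) \<in> Pol1"
  using assms
proof (rule Pol1E)
  fix t es
  assume "vars t \<subseteq> {..length es}" "p = (\<lambda>x. eval_term (nth (x # es)) t)"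
  then show ?thesis
    using Pol1I[of "Alpha t" es] by simp
qed

lemma Pol1_mult:
  assumes "p \<in> Pol1" "q \<in> Pol1"
  shows "(\<lambda>x. p x * q x) \<in> Pol1"
  using assms
proof (rule Pol1_common_parameters)
  fix s t es
  assume "vars s \<subseteq> {..length es}" "vars t \<subseteq> {..length es}"
    "p = (\<lambda>x. eval_term (nth (x # es)) s)" "q = (\<lambda>x. eval_term (nth (x # es)) t)"
  then show ?thesis
    using Pol1I[of "Mult s t" es] by simp
qed

lemma Pol1_add: "p \<in> Pol1 \<Longrightarrow> q \<in> Pol1 \<Longrightarrow> (\<lambda>x. p x + q x) \<in> Pol1"
  unfolding add_eq_mult_alpha by (intro Pol1_mult Pol1_alpha)

lemma Pol1_near_meet: "p \<in> Pol1 \<Longrightarrow> q \<in> Pol1 \<Longrightarrow> (\<lambda>x. near_meet (p x) (q x)) \<in> Pol1"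
  unfolding near_meet_def by (intro Pol1_mult Pol1_alpha)

subsection \<open>Congruences and ideals\<close>

definition is_congruence :: "('a::lukasiewicz_near_semiring \<Rightarrow> 'a \<Rightarrow> bool) \<Rightarrow> bool" where
  "is_congruence R \<longleftrightarrow>
     equivp R \<and>
     (\<forall>x y u v. R x y \<and> R u v \<longrightarrow> R (x + u) (y + v)) \<and>
     (\<forall>x y u v. R x y \<and> R u v \<longrightarrow> R (x * u) (y * v)) \<and>
     (\<forall>x y. R x y \<longrightarrow> R (x\<^sup>\<alpha>) (y\<^sup>\<alpha>))"

lemma is_congruenceI:
  assumes "equivp R"
    and mult: "\<And>x y u v. R x y \<Longrightarrow> R u v \<Longrightarrow> R (x * u) (y * v)"
    and alpha: "\<And>x y. R x y \<Longrightarrow> R (x\<^sup>\<alpha>) (y\<^sup>\<alpha>)"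
  shows "is_congruence R"
  unfolding is_congruence_def by (simp add: assms add_eq_mult_alpha)

lemma is_congruence_eval_term:
  assumes "is_congruence R" "\<And>i. R (\<sigma> i) (\<tau> i)"
  shows "R (eval_term \<sigma> t) (eval_term \<tau> t)"
  using assms by (induction t) (simp_all add: is_congruence_def equivp_reflp)

lemma is_congruence_Pol1:
  assumes R: "is_congruence R" and "R x y" "p \<in> Pol1"
  shows "R (p x) (p y)"
  using \<open>p \<in> Pol1\<close>
proof (rule Pol1E)
  fix t es
  assume p: "p = (\<lambda>x. eval_term (nth (x # es)) t)"
  have "R ((x # es) ! i) ((y # es) ! i)" for i
    using R \<open>R x y\<close> by (cases i) (simp_all add: is_congruence_def equivp_reflp)
  then show ?thesis
    unfolding p by (rule is_congruence_eval_term[OF R])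
qed

definition ideal_rel :: "'a::lukasiewicz_near_semiring set \<Rightarrow> 'a \<Rightarrow> 'a \<Rightarrow> bool"
  where "ideal_rel J x y \<longleftrightarrow> x\<^sup>\<alpha> * y \<in> J \<and> y\<^sup>\<alpha> * x \<in> J"

lemma ideal_rel_sym: "ideal_rel J x y \<Longrightarrow> ideal_rel J y x"
  by (simp add: ideal_rel_def)

lemma is_ideal_iff_ideal_rel:
  "is_ideal J \<longleftrightarrow>
     0 \<in> J \<and>
     (\<forall>x y. x * y\<^sup>\<alpha> \<in> J \<and> y \<in> J \<longrightarrow> x \<in> J) \<and>
     (\<forall>x y c. ideal_rel J x y \<longrightarrow> ideal_rel J (x * c) (y * c) \<and> ideal_rel J (c * x) (c * y))"
  unfolding is_ideal_def ideal_rel_def by blast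

lemma is_ideal_zero: "is_ideal J \<Longrightarrow> 0 \<in> J"
  by (simp add: is_ideal_def)

lemma is_ideal_cancel: "is_ideal J \<Longrightarrow> x * y\<^sup>\<alpha> \<in> J \<Longrightarrow> y \<in> J \<Longrightarrow> x \<in> J"
  unfolding is_ideal_def by blast

lemma ideal_rel_mult_left: "is_ideal J \<Longrightarrow> ideal_rel J x y \<Longrightarrow> ideal_rel J (c * x) (c * y)"
  unfolding is_ideal_iff_ideal_rel by blast

lemma ideal_rel_mult_right: "is_ideal J \<Longrightarrow> ideal_rel J x y \<Longrightarrow> ideal_rel J (x * c) (y * c)"
  unfolding is_ideal_iff_ideal_rel by blast

lemma ideal_rel_refl: "is_ideal J \<Longrightarrow> ideal_rel J x x"
  by (simp add: ideal_rel_def alpha_mult_self is_ideal_zero)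

lemma ideal_rel_zero_iff: "is_ideal J \<Longrightarrow> ideal_rel J x 0 \<longleftrightarrow> x \<in> J"
  by (simp add: ideal_rel_def alpha_zero mult_one_left is_ideal_zero)

lemma ideal_rel_mult_alpha_mem:
  assumes "is_ideal J" "ideal_rel J x y"
  shows "x * y\<^sup>\<alpha> \<in> J"
proof -
  have "ideal_rel J (x * y\<^sup>\<alpha>) (y * y\<^sup>\<alpha>)"
    using assms by (rule ideal_rel_mult_right)
  then show ?thesis
    by (simp add: mult_alpha_self ideal_rel_zero_iff[OF assms(1)])
qed

lemma ideal_rel_alpha:
  assumes "is_ideal J" "ideal_rel J x y"
  shows "ideal_rel J (x\<^sup>\<alpha>) (y\<^sup>\<alpha>)"
  unfolding ideal_rel_def alpha_involutive
  using assms by (blast intro: ideal_rel_mult_alpha_mem ideal_rel_sym)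

lemma ideal_rel_mem:
  assumes "is_ideal J" "ideal_rel J x y" "y \<in> J"
  shows "x \<in> J"
  using assms(1) ideal_rel_mult_alpha_mem[OF assms(1,2)] assms(3) by (rule is_ideal_cancel)

lemma ideal_rel_trans:
  assumes J: "is_ideal J" and xy: "ideal_rel J x y" and yz: "ideal_rel J y z"
  shows "ideal_rel J x z"
proof -
  have alpha_mult_mem: "u\<^sup>\<alpha> * w \<in> J" if "ideal_rel J u v" "ideal_rel J v w" for u v w
  proof (rule ideal_rel_mem[OF J])
    show "ideal_rel J (u\<^sup>\<alpha> * w) (v\<^sup>\<alpha> * w)"
      using that(1) by (intro ideal_rel_mult_right ideal_rel_alpha J)
    show "v\<^sup>\<alpha> * w \<in> J"
      using that(2) by (simp add: ideal_rel_def)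
  qed
  show ?thesis
    using alpha_mult_mem[OF xy yz] alpha_mult_mem[OF ideal_rel_sym[OF yz] ideal_rel_sym[OF xy]]
    by (simp add: ideal_rel_def)
qed

lemma is_congruence_ideal_rel:
  assumes J: "is_ideal J"
  shows "is_congruence (ideal_rel J)"
proof (rule is_congruenceI)
  show "equivp (ideal_rel J)"
    by (intro equivpI reflpI sympI transpI)
      (blast intro: ideal_rel_refl[OF J] ideal_rel_sym ideal_rel_trans[OF J])+
  show "ideal_rel J (x * u) (y * v)" if "ideal_rel J x y" "ideal_rel J u v" for x y u v
    using that ideal_rel_trans[OF J ideal_rel_mult_right[OF J] ideal_rel_mult_left[OF J]] by blast
  show "ideal_rel J (x\<^sup>\<alpha>) (y\<^sup>\<alpha>)" if "ideal_rel J x y" for x y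
    using J that by (rule ideal_rel_alpha)
qed

lemma is_ideal_Pol1_mem:
  assumes J: "is_ideal J" and "a \<in> J" "p \<in> Pol1" "p 0 = 0"
  shows "p a \<in> J"
proof -
  have "ideal_rel J a 0"
    using \<open>a \<in> J\<close> by (simp add: ideal_rel_zero_iff[OF J])
  then have "ideal_rel J (p a) (p 0)"
    using \<open>p \<in> Pol1\<close> by (rule is_congruence_Pol1[OF is_congruence_ideal_rel[OF J]])
  then show ?thesis
    by (simp add: \<open>p 0 = 0\<close> ideal_rel_zero_iff[OF J])
qed

subsection \<open>Values of the polynomials that fix zero\<close>

definition zero_Pol1_values :: "'a::lukasiewicz_near_semiring \<Rightarrow> 'a set"
  where "zero_Pol1_values a = {p a | p. p \<in> Pol1 \<and> p 0 = 0}"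

lemma zero_Pol1_valuesI: "p \<in> Pol1 \<Longrightarrow> p 0 = 0 \<Longrightarrow> p a \<in> zero_Pol1_values a"
  by (auto simp: zero_Pol1_values_def)

lemma zero_Pol1_valuesE:
  assumes "x \<in> zero_Pol1_values a"
  obtains p where "p \<in> Pol1" "p 0 = 0" "p a = x"
  using assms by (auto simp: zero_Pol1_values_def)

lemma zero_Pol1_values_downward:
  assumes "y \<in> zero_Pol1_values a" "x \<sqsubseteq> y"
  shows "x \<in> zero_Pol1_values a"
  using assms(1)
proof (rule zero_Pol1_valuesE)
  fix p assume p: "p \<in> Pol1" "p 0 = 0" "p a = y"
  then have "near_meet x (p a) \<in> zero_Pol1_values a"
    by (intro zero_Pol1_valuesI[of "\<lambda>z. near_meet x (p z)"] Pol1_near_meet Pol1_const)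
      simp_all
  then show ?thesis
    by (simp add: p near_meet_absorb assms(2))
qed

lemma zero_Pol1_values_alpha_mult_alpha:
  assumes "x \<in> zero_Pol1_values a" "y \<in> zero_Pol1_values a"
  shows "(x\<^sup>\<alpha> * y\<^sup>\<alpha>)\<^sup>\<alpha> \<in> zero_Pol1_values a"
proof -
  obtain p q where p: "p \<in> Pol1" "p 0 = 0" "p a = x" and q: "q \<in> Pol1" "q 0 = 0" "q a = y"
    using assms by (auto elim!: zero_Pol1_valuesE)
  then show ?thesis
    using zero_Pol1_valuesI[of "\<lambda>z. ((p z)\<^sup>\<alpha> * (q z)\<^sup>\<alpha>)\<^sup>\<alpha>" a]
    by (simp add: Pol1_alpha Pol1_mult alpha_zero alpha_one mult_one_left)
qed

lemma zero_Pol1_values_cancel: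
  assumes "x * y\<^sup>\<alpha> \<in> zero_Pol1_values a" "y \<in> zero_Pol1_values a"
  shows "x \<in> zero_Pol1_values a"
proof (rule zero_Pol1_values_downward)
  show "x + y \<in> zero_Pol1_values a"
    using zero_Pol1_values_alpha_mult_alpha[OF assms] by (simp flip: add_eq_mult_alpha)
  show "x \<sqsubseteq> x + y"
    by (rule join.sup_ge1)
qed

lemma ideal_rel_zero_Pol1_valuesI:
  assumes "f \<in> Pol1" "g \<in> Pol1" "f 0 = g 0"
  shows "ideal_rel (zero_Pol1_values a) (f a) (g a)"
  unfolding ideal_rel_def using assms
    zero_Pol1_valuesI[of "\<lambda>z. (f z)\<^sup>\<alpha> * g z" a] zero_Pol1_valuesI[of "\<lambda>z. (g z)\<^sup>\<alpha> * f z" a]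
  by (simp add: Pol1_mult Pol1_alpha alpha_mult_self)

lemma ideal_rel_zero_Pol1_valuesE:
  assumes "ideal_rel (zero_Pol1_values a) x y"
  obtains f g where "f \<in> Pol1" "g \<in> Pol1" "f 0 = g 0" "f a = x" "g a = y"
proof -
  obtain p q where p: "p \<in> Pol1" "p 0 = 0" "p a = x\<^sup>\<alpha> * y"
    and q: "q \<in> Pol1" "q 0 = 0" "q a = y\<^sup>\<alpha> * x"
    using assms by (auto simp: ideal_rel_def elim!: zero_Pol1_valuesE)
  show thesis
  proof (rule that)
    show "(\<lambda>z. (p z)\<^sup>\<alpha> * y + x) \<in> Pol1" "(\<lambda>z. (q z)\<^sup>\<alpha> * x + y) \<in> Pol1"
      by (intro Pol1_add Pol1_mult Pol1_alpha Pol1_const p q)+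
    show "(p 0)\<^sup>\<alpha> * y + x = (q 0)\<^sup>\<alpha> * x + y"
      by (simp add: p q alpha_zero mult_one_left add.commute)
    have absorb: "(u\<^sup>\<alpha> * v)\<^sup>\<alpha> * v + u = u" for u v :: 'a
      using near_lattice.inf_le1[of u v] by (simp add: near_meet_def join_le_def)
    show "(p a)\<^sup>\<alpha> * y + x = x" "(q a)\<^sup>\<alpha> * x + y = y"
      by (simp_all add: p q absorb)
  qed
qed

lemma is_ideal_zero_Pol1_values: "is_ideal (zero_Pol1_values a)"
proof -
  let ?V = "zero_Pol1_values a"
  have "0 \<in> ?V"
    by (rule zero_Pol1_valuesI[OF Pol1_const refl])
  moreover have "ideal_rel ?V (x * c) (y * c)" "ideal_rel ?V (c * x) (c * y)"
    if xy: "ideal_rel ?V x y" for x y c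
  proof -
    obtain f g where f: "f \<in> Pol1" "f a = x" and g: "g \<in> Pol1" "g a = y" and "f 0 = g 0"
      using xy by (rule ideal_rel_zero_Pol1_valuesE)
    then show "ideal_rel ?V (x * c) (y * c)" "ideal_rel ?V (c * x) (c * y)"
      using ideal_rel_zero_Pol1_valuesI[of "\<lambda>z. f z * c" "\<lambda>z. g z * c" a]
        ideal_rel_zero_Pol1_valuesI[of "\<lambda>z. c * f z" "\<lambda>z. c * g z" a]
      by (simp_all add: Pol1_mult Pol1_const)
  qed
  ultimately show ?thesis
    unfolding is_ideal_iff_ideal_rel by (blast intro: zero_Pol1_values_cancel)
qed

theorem theorem5:
  fixes a :: "'a::lukasiewicz_near_semiring"
  shows "is_least_ideal_containing a {p a | p. p \<in> Pol1 \<and> p 0 = 0}"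
  unfolding is_least_ideal_containing_def zero_Pol1_values_def[symmetric]
proof (intro conjI allI impI subsetI)
  show "is_ideal (zero_Pol1_values a)"
    by (rule is_ideal_zero_Pol1_values)
  show "a \<in> zero_Pol1_values a"
    by (rule zero_Pol1_valuesI[OF Pol1_id]) simp
  show "x \<in> J" if "is_ideal J \<and> a \<in> J" "x \<in> zero_Pol1_values a" for J x
    using that by (auto elim!: zero_Pol1_valuesE intro: is_ideal_Pol1_mem)
qed

end
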